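(* Let $(H, \preceq)$ be a locally artinian premon. Then for every $s \in \mathbb{N}_{\ge 2} \cup \{\infty\}$, every $\preceq$-non-unit of $H$ factors as a product of (finitely many) $\preceq$-irreducibles of degree $s$. In particular, $H$ is a $\preceq$-factorable monoid.
   Context: A premon is a pair $(H, \preceq)$ consisting of a (multiplicatively written, not necessarily commutative) monoid $H$ with identity $1_H$ and a preorder $\preceq$ (a reflexive and transitive binary relation) on the carrier set of $H$; no compatibility between the operation and the preorder is assumed. Write $x \prec y$ if $x \preceq y$ and $y \not\preceq x$. An element $u \in H$ is a $\preceq$-unit if $u \preceq 1_H \preceq u$, and a $\preceq$-non-unit otherwise. For $s \in \mathbb{N}_{\ge 2} \cup \{\infty\}$, a $\preceq$-irreducible of degree $s$ is a $\preceq$-non-unit $a \in H$ such that $a \ne x_1 \cdots x_k$ for every integer $k$ with $2 \le k \le s$ and all $\preceq$-non-units $x_1, \ldots, x_k \in H$ with $x_i \prec a$ for each $i$. A $\preceq$-irreducible (with no degree specified) is a $\preceq$-irreducible of degree $2$. An element $x \in H$ is $\preceq$-artinian if there is no infinite sequence $x_1, x_2, \ldots$ in $H$ with $x_1 = x$ and $x_{i+1} \prec x_i$ for all $i \ge 1$. The premon $(H,\preceq)$ is locally artinian if every $\preceq$-non-unit is a product of finitely many $\preceq$-artinian $\preceq$-non-units. The monoid $H$ is $\preceq$-factorable if every $\preceq$-non-unit is a product of finitely many $\preceq$-irreducibles. *)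

theory Defs
  imports "HOL-Algebra.Group" "HOL-Library.Extended_Nat"
begin

text \<open>
  A premon is a monoid \<open>H\<close> with a preorder on its carrier. No compatibility between the
  preorder and the multiplication is assumed.
\<close>

locale premon = monoid H for H (structure) +
  fixes le :: "'a rel"
  assumes preorder: "preorder_on (carrier H) le"
begin

abbreviation less_eq (infix \<open>\<preceq>\<close> 50)
  where "x \<preceq> y \<equiv> (x, y) \<in> le"

abbreviation less (infix \<open>\<prec>\<close> 50)
  where "x \<prec> y \<equiv> x \<preceq> y \<and> \<not> y \<preceq> x"

definition pre_unit :: "'a \<Rightarrow> bool"
  where "pre_unit u \<longleftrightarrow> u \<in> carrier H \<and> u \<preceq> \<one> \<and> \<one> \<preceq> u"

definition pre_nonunit :: "'a \<Rightarrow> bool"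
  where "pre_nonunit x \<longleftrightarrow> x \<in> carrier H \<and> \<not> pre_unit x"

definition list_product :: "'a list \<Rightarrow> 'a"
  where "list_product xs = foldr (\<otimes>) xs \<one>"

text \<open>
  The degree \<open>s\<close> ranges over the extended naturals, and only \<open>s \<ge> 2\<close> is meaningful. As \<open>length xs\<close>
  is finite, \<open>s = \<infinity>\<close> puts no upper bound on the number of factors.
\<close>

definition pre_irreducible_deg :: "enat \<Rightarrow> 'a \<Rightarrow> bool"
  where "pre_irreducible_deg s a \<longleftrightarrow>
    pre_nonunit a \<and>
    (\<forall>xs. 2 \<le> length xs \<and> enat (length xs) \<le> s \<and> (\<forall>x \<in> set xs. pre_nonunit x \<and> x \<prec> a)
      \<longrightarrow> a \<noteq> list_product xs)"

definition pre_irreducible :: "'a \<Rightarrow> bool"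
  where "pre_irreducible a \<longleftrightarrow> pre_irreducible_deg 2 a"

definition pre_artinian :: "'a \<Rightarrow> bool"
  where "pre_artinian x \<longleftrightarrow>
    x \<in> carrier H \<and>
    \<not> (\<exists>f :: nat \<Rightarrow> 'a. f 0 = x \<and> (\<forall>i. f i \<in> carrier H) \<and> (\<forall>i. f (Suc i) \<prec> f i))"

text \<open>
  The empty product is \<open>\<one>\<close>, which is never a non-unit, so factorizations of non-units are
  automatically nonempty.
\<close>

definition product_of :: "('a \<Rightarrow> bool) \<Rightarrow> 'a \<Rightarrow> bool"
  where "product_of P x \<longleftrightarrow> (\<exists>xs. (\<forall>y \<in> set xs. P y) \<and> x = list_product xs)"

definition locally_artinian :: bool
  where "locally_artinian \<longleftrightarrow>
    (\<forall>x. pre_nonunit x \<longrightarrow> product_of (\<lambda>y. pre_artinian y \<and> pre_nonunit y) x)"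

definition factorable :: bool
  where "factorable \<longleftrightarrow> (\<forall>x. pre_nonunit x \<longrightarrow> product_of pre_irreducible x)"

end

end

theory Submission
  imports Defs
begin

text \<open>
  Call a non-unit bad if it is not a product of \<open>\<preceq>\<close>-irreducibles of degree \<open>s\<close>. A bad element
  is in particular not irreducible, so it is a product of non-units strictly below it. Products of
  products of irreducibles are again products of irreducibles, so one of these factors is bad
  (\<open>bad_descent\<close>). Iterating, a bad element starts an infinite strictly decreasing sequence, so no
  \<open>\<preceq>\<close>-artinian element is bad. Local artinianity writes an arbitrary non-unit as a product of
  artinian non-units, and factoring each of these into irreducibles finishes the proof.
\<close>

context premon
begin

lemma list_product_closed:
  "set xs \<subseteq> carrier H \<Longrightarrow> list_product xs \<in> carrier H"
  unfolding list_product_def by (induction xs) auto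

lemma list_product_append:
  assumes "set xs \<subseteq> carrier H" "set ys \<subseteq> carrier H"
  shows "list_product (xs @ ys) = list_product xs \<otimes> list_product ys"
  using assms(1)
proof (induction xs)
  case Nil
  then show ?case
    using list_product_closed[OF assms(2)] by (simp add: list_product_def)
next
  case (Cons x xs)
  then show ?case
    using list_product_closed[of xs] list_product_closed[OF assms(2)]
    by (simp add: list_product_def m_assoc)
qed

lemma product_of_list_product:
  assumes "\<And>y. P y \<Longrightarrow> y \<in> carrier H" "\<forall>x \<in> set xs. product_of P x"
  shows "product_of P (list_product xs)"
  using assms(2)
proof (induction xs)
  case Nil
  show ?case
    unfolding product_of_def by (intro exI[of _ "[]"]) simp
next
  case (Cons x xs)
  obtain us where us: "\<forall>y \<in> set us. P y" "x = list_product us"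
    using Cons.prems by (auto simp: product_of_def)
  obtain vs where vs: "\<forall>y \<in> set vs. P y" "list_product xs = list_product vs"
    using Cons by (auto simp: product_of_def)
  have "list_product (x # xs) = x \<otimes> list_product xs"
    by (simp add: list_product_def)
  also have "\<dots> = list_product (us @ vs)"
    using us vs assms(1) by (subst list_product_append) auto
  finally show ?case
    using us(1) vs(1) unfolding product_of_def by (intro exI[of _ "us @ vs"]) auto
qed

lemma pre_irreducible_deg_nonunit: "pre_irreducible_deg s a \<Longrightarrow> pre_nonunit a"
  by (simp add: pre_irreducible_deg_def)

lemma pre_nonunit_closed: "pre_nonunit x \<Longrightarrow> x \<in> carrier H"
  by (simp add: pre_nonunit_def)

lemma product_of_self:
  assumes "P x" "x \<in> carrier H"
  shows "product_of P x"
  unfolding product_of_def list_product_def using assms by (intro exI[of _ "[x]"]) simp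

text \<open>
  If every factor in a factorization witnessing that \<open>b\<close> is reducible were a product of
  irreducibles, concatenating these products would give one for \<open>b\<close>.
\<close>

lemma bad_descent:
  assumes "pre_nonunit b" "\<not> product_of (pre_irreducible_deg s) b"
  obtains c where "pre_nonunit c" "\<not> product_of (pre_irreducible_deg s) c" "c \<prec> b"
proof -
  have "\<not> pre_irreducible_deg s b"
    using assms product_of_self pre_nonunit_closed by blast
  then obtain xs where xs: "\<forall>x \<in> set xs. pre_nonunit x \<and> x \<prec> b" "b = list_product xs"
    using assms(1) by (auto simp: pre_irreducible_deg_def)
  have "\<not> (\<forall>x \<in> set xs. product_of (pre_irreducible_deg s) x)"
    using product_of_list_product[of "pre_irreducible_deg s" xs] assms(2) xs(2)
      pre_irreducible_deg_nonunit pre_nonunit_closed by blast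
  then show thesis
    using xs(1) that by blast
qed

text \<open>
  Being artinian is a condition on the descending sequences from \<open>x\<close> alone, so \<open>bad_descent\<close> is
  iterated along one sequence starting at \<open>x\<close>.
\<close>

lemma artinian_nonunit_product_of_irreducibles:
  assumes "pre_artinian x" "pre_nonunit x"
  shows "product_of (pre_irreducible_deg s) x"
proof (rule ccontr)
  assume bad: "\<not> product_of (pre_irreducible_deg s) x"
  define B where "B b \<longleftrightarrow> pre_nonunit b \<and> \<not> product_of (pre_irreducible_deg s) b" for b
  \<comment> \<open>The clause for \<open>n = 0\<close> makes the chosen sequence start at \<open>x\<close>.\<close>
  have "\<exists>f. \<forall>n::nat. (B (f n) \<and> (n = 0 \<longrightarrow> f n = x)) \<and> f (Suc n) \<prec> f n"
  proof (rule dependent_nat_choice)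
    show "\<exists>b. B b \<and> ((0::nat) = 0 \<longrightarrow> b = x)"
      using assms(2) bad by (auto simp: B_def)
  next
    fix b and n :: nat
    assume "B b \<and> (n = 0 \<longrightarrow> b = x)"
    then show "\<exists>c. (B c \<and> (Suc n = 0 \<longrightarrow> c = x)) \<and> c \<prec> b"
      using bad_descent[of b s] unfolding B_def by (metis nat.distinct(1))
  qed
  then obtain f where "\<forall>n::nat. (B (f n) \<and> (n = 0 \<longrightarrow> f n = x)) \<and> f (Suc n) \<prec> f n" ..
  then have "f 0 = x" "\<forall>n. f n \<in> carrier H" "\<forall>n. f (Suc n) \<prec> f n"
    by (auto simp: B_def pre_nonunit_closed)
  then show False
    using assms(1) unfolding pre_artinian_def by blast
qed

lemma nonunit_product_of_irreducibles:
  assumes "locally_artinian" "pre_nonunit x"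
  shows "product_of (pre_irreducible_deg s) x"
proof -
  obtain xs where xs: "\<forall>y \<in> set xs. pre_artinian y \<and> pre_nonunit y" "x = list_product xs"
    using assms unfolding locally_artinian_def product_of_def by blast
  have "product_of (pre_irreducible_deg s) (list_product xs)"
    using xs(1) artinian_nonunit_product_of_irreducibles
      pre_irreducible_deg_nonunit pre_nonunit_closed
    by (intro product_of_list_product) blast+
  then show ?thesis
    by (simp add: xs(2))
qed

end

theorem theorem2p4:
  fixes H :: "('a, 'b) monoid_scheme" and le :: "'a rel"
  assumes "premon H le"
    and "premon.locally_artinian H le"
  shows "(\<forall>s :: enat. 2 \<le> s \<longrightarrow>
            (\<forall>x. premon.pre_nonunit H le x \<longrightarrow>
                 premon.product_of H (premon.pre_irreducible_deg H le s) x))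
         \<and> premon.factorable H le"
proof -
  interpret premon H le by (rule assms(1))
  have "pre_irreducible = pre_irreducible_deg 2"
    by (rule ext) (simp add: pre_irreducible_def)
  then show ?thesis
    using nonunit_product_of_irreducibles[OF assms(2)] by (simp add: factorable_def)
qed

end
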